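(* Let $D_S$ be a digraph with self-loops of order $n$ with $\sigma$ self-loops ($0\le\sigma\le n$), and let $\overline{D_S}$ be its complement. Let $\rho$ and $\overline\rho$ be the spectral radii of $D_S$ and $\overline{D_S}$ respectively, and let $c_2$ and $\overline{c_2}$ be the numbers defined in the context for $D_S$ and $\overline{D_S}$ respectively. Then $$1-\delta_\sigma+\frac{c_2+\overline{c_2}}{n}\le\rho+\overline\rho\le1-\delta_\sigma+\sqrt{(n-1)^2-\frac{4\sigma(n-\sigma)}{n^2}+\frac{4\sigma(n-\sigma)}{n}+\frac{(n-1)(c_2+\overline{c_2})}{n}}.$$
   Context: A digraph with self-loops $D_S$ is a pair $(V,\mathcal A)$ with $V$ a nonempty finite vertex set and $\mathcal A\subseteq V\times V$ a set of arcs; $S=\{v\in V:(v,v)\in\mathcal A\}$ is the self-loop set (possibly empty). The order is $n=|V|$ and $\sigma=|S|$. The adjacency matrix $A(D_S)=(a_{ij})$ has $a_{ij}=1$ if $(v_i,v_j)\in\mathcal A$ and $0$ otherwise; the spectral radius of the digraph is that of its adjacency matrix. For a digraph with self-loops, $c_2$ is the number of closed walks $vwv$ with $v\ne w$, i.e. the number of ordered pairs $(v,w)$ with $v\ne w$ such that both $(v,w)$ and $(w,v)$ are arcs; $\overline{c_2}$ is this number for $\overline{D_S}$. Put $\delta_\sigma=1$ if $\sigma=0$ and $\delta_\sigma=0$ if $\sigma\ne0$. The complement $\overline{D_S}$ is the digraph with self-loops on $V$ with adjacency matrix $A(\overline{D_S})=J_n-\delta_\sigma I_n-A(D_S)$,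 where $J_n$ is the all-ones matrix and $I_n$ the identity matrix. *)

theory Defs
  imports "Graph_Theory.Pair_Digraph" "Jordan_Normal_Form.Spectral_Radius"
begin

text \<open>A digraph with self-loops is a \<^typ>\<open>'a pair_pre_digraph\<close> \<open>D\<close> with
  \<open>pair_fin_digraph D\<close> and a nonempty vertex set \<open>pverts D\<close>.\<close>

definition loop_set :: "'a pair_pre_digraph \<Rightarrow> 'a set" where
  "loop_set D = {v \<in> pverts D. (v, v) \<in> parcs D}"

definition loop_delta :: "'a pair_pre_digraph \<Rightarrow> 'b::zero_neq_one" where
  "loop_delta D = (if card (loop_set D) = 0 then 1 else 0)"

definition c2 :: "'a pair_pre_digraph \<Rightarrow> nat" where
  "c2 D = card {(v, w). v \<noteq> w \<and> (v, w) \<in> parcs D \<and> (w, v) \<in> parcs D}"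

text \<open>The list \<open>vs = [v\<^sub>1, \<dots>, v\<^sub>n]\<close> is an enumeration of the vertices. The entries are complex
  because \<^const>\<open>spectral_radius\<close> is defined on complex matrices.\<close>

definition adjacency_mat :: "'a list \<Rightarrow> 'a pair_pre_digraph \<Rightarrow> complex mat" where
  "adjacency_mat vs D = mat (length vs) (length vs)
     (\<lambda>(i, j). if (vs ! i, vs ! j) \<in> parcs D then 1 else 0)"

text \<open>If \<open>D\<close> has at least one self-loop, then the complement has a self-loop exactly at the vertices
  where \<open>D\<close> has none; if \<open>D\<close> has no self-loop, then neither has its complement. The lemma
  \<open>adjacency_mat_complement\<close> below shows that this is the digraph with adjacency matrix
  \<open>J - \<delta> I - A\<close>.\<close>

definition digraph_complement :: "'a pair_pre_digraph \<Rightarrow> 'a pair_pre_digraph" where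
  "digraph_complement D = \<lparr> pverts = pverts D,
     parcs = {(u, v). u \<in> pverts D \<and> v \<in> pverts D \<and> (u, v) \<notin> parcs D \<and>
       (card (loop_set D) = 0 \<longrightarrow> u \<noteq> v)} \<rparr>"

lemma pair_fin_digraph_complement:
  assumes "pair_fin_digraph D"
  shows "pair_fin_digraph (digraph_complement D)"
proof -
  interpret pair_fin_digraph D by fact
  have "parcs (digraph_complement D) \<subseteq> pverts D \<times> pverts D"
    by (auto simp: digraph_complement_def)
  then have "finite (parcs (digraph_complement D))"
    by (rule finite_subset) simp
  then show ?thesis
    by unfold_locales (auto simp: digraph_complement_def)
qed

lemma adjacency_mat_complement:
  assumes "pair_fin_digraph D" "distinct vs" "set vs = pverts D"
  shows "adjacency_mat vs (digraph_complement D) =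
    mat (length vs) (length vs) (\<lambda>_. 1) - loop_delta D \<cdot>\<^sub>m 1\<^sub>m (length vs) - adjacency_mat vs D"
    (is "?L = ?R")
proof (rule eq_matI)
  interpret pair_fin_digraph D by fact
  show "dim_row ?L = dim_row ?R" "dim_col ?L = dim_col ?R"
    by (simp_all add: adjacency_mat_def)
  fix i j assume "i < dim_row ?R" "j < dim_col ?R"
  then have ij: "i < length vs" "j < length vs" by (simp_all add: adjacency_mat_def)
  then have mem: "vs ! i \<in> pverts D" "vs ! j \<in> pverts D"
    using assms(3) nth_mem by blast+
  have eq: "vs ! i = vs ! j \<longleftrightarrow> i = j"
    using ij assms(2) by (simp add: nth_eq_iff_index_eq)
  have fin: "finite (loop_set D)" by (simp add: loop_set_def)
  have noloop: "(vs ! i, vs ! i) \<notin> parcs D" if "card (loop_set D) = 0"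
    using that fin mem by (auto simp: loop_set_def)
  show "?L $$ (i, j) = ?R $$ (i, j)"
    using ij mem eq noloop
    by (auto simp: adjacency_mat_def digraph_complement_def loop_delta_def)
qed

end

theory Submission
  imports Defs "HOL-Analysis.L2_Norm"
begin

text \<open>For the upper bounds, let \<open>y\<close> be the vector of absolute values of a unit eigenvector whose
  eigenvalue has maximal modulus. Then \<open>\<rho> \<le> y\<^sup>T A y = y\<^sup>T H y\<close> with \<open>H = (A + A\<^sup>T) / 2\<close>, and the
  Cauchy-Schwarz inequality for the trace inner product of \<open>H - (tr H / n) I\<close> and \<open>y y\<^sup>T - I / n\<close>
  bounds this by \<open>tr H / n + sqrt ((1 - 1 / n) (\<parallel>H\<parallel>\<^sup>2 - (tr H)\<^sup>2 / n))\<close>, where \<open>tr H = \<sigma>\<close> and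
  \<open>2 \<parallel>H\<parallel>\<^sup>2\<close> is the number of arcs plus \<open>c\<^sub>2 + \<sigma>\<close>. The number of arcs cancels when the bounds for the
  digraph and its complement are combined through \<open>sqrt x + sqrt y \<le> sqrt (2 (x + y))\<close>.

  For the lower bounds, let \<open>B\<close> be the symmetric matrix with entries \<open>a\<^sub>i\<^sub>j a\<^sub>j\<^sub>i \<le> a\<^sub>i\<^sub>j\<close>, and write \<open>e\<close>
  for the all-ones vector. Symmetry gives \<open>(e\<^sup>T B\<^sup>k e)\<^sup>2 \<le> n (e\<^sup>T B\<^sup>2\<^sup>k e)\<close>, so \<open>e\<^sup>T A\<^sup>k e \<ge> e\<^sup>T B\<^sup>k e\<close>
  grows along powers of two at least like the powers of \<open>e\<^sup>T B e / n = (c\<^sub>2 + \<sigma>) / n\<close>, whereas the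
  spectral radius controls the growth of \<open>A\<^sup>k\<close>.\<close>

section \<open>Real matrices given by entry functions\<close>

definition real_mat :: "nat \<Rightarrow> (nat \<Rightarrow> nat \<Rightarrow> real) \<Rightarrow> complex mat" where
  "real_mat n a = mat n n (\<lambda>(i, j). complex_of_real (a i j))"

text \<open>Matrix-vector multiplication on real-valued functions, so that iterates can be compared
  by order. Values at indices from \<open>n\<close> on are never fed back, since the sum stops below
  \<open>n\<close>.\<close>

definition mat_action :: "nat \<Rightarrow> (nat \<Rightarrow> nat \<Rightarrow> real) \<Rightarrow> (nat \<Rightarrow> real) \<Rightarrow> nat \<Rightarrow> real" where
  "mat_action n a f i = (\<Sum>j<n. a i j * f j)"

lemma real_mat_carrier [simp]: "real_mat n a \<in> carrier_mat n n"
  by (simp add: real_mat_def)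

lemma dim_row_real_mat [simp]: "dim_row (real_mat n a) = n"
  by (simp add: real_mat_def)

lemma dim_col_real_mat [simp]: "dim_col (real_mat n a) = n"
  by (simp add: real_mat_def)

section \<open>Upper bound through a quadratic form\<close>

lemma sum_mult_square_le:
  fixes f g :: "'a \<Rightarrow> real"
  shows "(\<Sum>i\<in>A. f i * g i)\<^sup>2 \<le> (\<Sum>i\<in>A. (f i)\<^sup>2) * (\<Sum>i\<in>A. (g i)\<^sup>2)"
proof -
  have "\<bar>\<Sum>i\<in>A. f i * g i\<bar> \<le> (\<Sum>i\<in>A. \<bar>f i\<bar> * \<bar>g i\<bar>)"
    using sum_abs[of "\<lambda>i. f i * g i" A] by (simp add: abs_mult)
  also have "\<dots> \<le> L2_set f A * L2_set g A"
    by (rule L2_set_mult_ineq)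
  finally have "\<bar>\<Sum>i\<in>A. f i * g i\<bar>\<^sup>2 \<le> (L2_set f A * L2_set g A)\<^sup>2"
    by (rule power_mono) simp
  then show ?thesis
    by (simp add: power_mult_distrib L2_set_def sum_nonneg)
qed

lemma quadratic_form_le:
  fixes h :: "'a \<Rightarrow> 'a \<Rightarrow> real" and w :: "'a \<Rightarrow> real"
  assumes "finite I" "I \<noteq> {}" and unit: "(\<Sum>i\<in>I. (w i)\<^sup>2) = 1"
  shows "(\<Sum>i\<in>I. \<Sum>j\<in>I. h i j * w i * w j) \<le> (\<Sum>i\<in>I. h i i) / card I +
    sqrt ((1 - 1 / card I) * ((\<Sum>i\<in>I. \<Sum>j\<in>I. (h i j)\<^sup>2) - (\<Sum>i\<in>I. h i i)\<^sup>2 / card I))"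
proof -
  define N where "N = real (card I)"
  define t where "t = (\<Sum>i\<in>I. h i i)"
  \<comment> \<open>\<open>d\<close> is the identity matrix, and \<open>?S\<close> of an entrywise
    product is the trace inner product. Subtracting \<open>t / N\<close> and \<open>1 / N\<close>
    times \<open>d\<close> projects \<open>h\<close> and the rank-one matrix of \<open>w\<close>
    onto the matrices of trace zero.\<close>
  define d where "d i j = (if i = j then 1 else 0 :: real)" for i j :: 'a
  let ?S = "\<lambda>f. \<Sum>i\<in>I. \<Sum>j\<in>I. f i j :: real"
  have N: "N > 0" using assms by (simp add: N_def card_gt_0_iff)
  have diag: "?S (\<lambda>i j. f i j * d i j) = (\<Sum>i\<in>I. f i i)" for f
  proof (rule sum.cong[OF refl])
    fix i assume "i \<in> I"
    have "(\<Sum>j\<in>I. f i j * d i j) = (\<Sum>j\<in>I. if i = j then f i j else 0)"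
      by (rule sum.cong) (auto simp: d_def)
    then show "(\<Sum>j\<in>I. f i j * d i j) = f i i"
      using \<open>i \<in> I\<close> assms(1) by simp
  qed
  have dd: "?S (\<lambda>i j. d i j) = N"
    using diag[of "\<lambda>_ _. 1"] by (simp add: N_def)
  have hd: "?S (\<lambda>i j. h i j * d i j) = t" by (simp only: diag t_def)
  have ww: "?S (\<lambda>i j. (w i)\<^sup>2 * (w j)\<^sup>2) = 1"
    by (simp add: sum_distrib_left[symmetric] unit)
  have wd: "?S (\<lambda>i j. (w i * w j) * d i j) = 1"
    using diag[of "\<lambda>i j. w i * w j"] unit by (simp add: power2_eq_square)
  \<comment> \<open>With entries 0 and 1, squares of \<open>d\<close> become linear, so the
    expansions below only involve the sums already evaluated.\<close>
  have d2: "(d i j)\<^sup>2 = d i j" for i j by (simp add: d_def)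
  have "?S (\<lambda>i j. (h i j - t / N * d i j) * (w i * w j - 1 / N * d i j))
      = ?S (\<lambda>i j. h i j * w i * w j - 1 / N * (h i j * d i j)
          - t / N * ((w i * w j) * d i j) + t / N\<^sup>2 * d i j)"
  proof (intro sum.cong refl)
    fix i j
    have "(h i j - t / N * d i j) * (w i * w j - 1 / N * d i j) = h i j * w i * w j
        - 1 / N * (h i j * d i j) - t / N * ((w i * w j) * d i j) + t / N\<^sup>2 * (d i j)\<^sup>2"
      by (simp add: algebra_simps power2_eq_square)
    then show "(h i j - t / N * d i j) * (w i * w j - 1 / N * d i j) = h i j * w i * w j
        - 1 / N * (h i j * d i j) - t / N * ((w i * w j) * d i j) + t / N\<^sup>2 * d i j"
      by (simp only: d2)
  qed
  also have "\<dots> = ?S (\<lambda>i j. h i j * w i * w j) - 1 / N * t - t / N * 1 + t / N\<^sup>2 * N"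
    by (simp only: sum.distrib sum_subtractf sum_distrib_left[symmetric] hd wd dd)
  finally have prod: "?S (\<lambda>i j. (h i j - t / N * d i j) * (w i * w j - 1 / N * d i j))
      = ?S (\<lambda>i j. h i j * w i * w j) - t / N"
    using N by (simp add: power2_eq_square)
  have "?S (\<lambda>i j. (h i j - t / N * d i j)\<^sup>2)
      = ?S (\<lambda>i j. (h i j)\<^sup>2 - 2 * t / N * (h i j * d i j) + (t / N)\<^sup>2 * d i j)"
  proof (intro sum.cong refl)
    fix i j
    have "(h i j - t / N * d i j)\<^sup>2
        = (h i j)\<^sup>2 - 2 * t / N * (h i j * d i j) + (t / N)\<^sup>2 * (d i j)\<^sup>2"
      by (simp add: algebra_simps power2_eq_square)
    then show "(h i j - t / N * d i j)\<^sup>2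
        = (h i j)\<^sup>2 - 2 * t / N * (h i j * d i j) + (t / N)\<^sup>2 * d i j"
      by (simp only: d2)
  qed
  also have "\<dots> = ?S (\<lambda>i j. (h i j)\<^sup>2) - 2 * t / N * t + (t / N)\<^sup>2 * N"
    by (simp only: sum.distrib sum_subtractf sum_distrib_left[symmetric] hd dd)
  finally have hsq: "?S (\<lambda>i j. (h i j - t / N * d i j)\<^sup>2) = ?S (\<lambda>i j. (h i j)\<^sup>2) - t\<^sup>2 / N"
    using N by (simp add: power2_eq_square)
  have "?S (\<lambda>i j. (w i * w j - 1 / N * d i j)\<^sup>2)
      = ?S (\<lambda>i j. (w i)\<^sup>2 * (w j)\<^sup>2 - 2 / N * ((w i * w j) * d i j) + 1 / N\<^sup>2 * d i j)"
  proof (intro sum.cong refl)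
    fix i j
    have "(w i * w j - 1 / N * d i j)\<^sup>2
        = (w i)\<^sup>2 * (w j)\<^sup>2 - 2 / N * ((w i * w j) * d i j) + 1 / N\<^sup>2 * (d i j)\<^sup>2"
      by (simp add: algebra_simps power2_eq_square)
    then show "(w i * w j - 1 / N * d i j)\<^sup>2
        = (w i)\<^sup>2 * (w j)\<^sup>2 - 2 / N * ((w i * w j) * d i j) + 1 / N\<^sup>2 * d i j"
      by (simp only: d2)
  qed
  also have "\<dots> = 1 - 2 / N * 1 + 1 / N\<^sup>2 * N"
    by (simp only: sum.distrib sum_subtractf sum_distrib_left[symmetric] unit mult_1_right wd dd)
  finally have wsq: "?S (\<lambda>i j. (w i * w j - 1 / N * d i j)\<^sup>2) = 1 - 1 / N"
    using N by (simp add: power2_eq_square)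
  have "(?S (\<lambda>i j. (h i j - t / N * d i j) * (w i * w j - 1 / N * d i j)))\<^sup>2
      \<le> ?S (\<lambda>i j. (h i j - t / N * d i j)\<^sup>2) * ?S (\<lambda>i j. (w i * w j - 1 / N * d i j)\<^sup>2)"
    \<comment> \<open>Matrices are treated as vectors indexed by
      \<open>I \<times> I\<close>.\<close>
    using sum_mult_square_le[of "\<lambda>(i, j). h i j - t / N * d i j"
        "\<lambda>(i, j). w i * w j - 1 / N * d i j" "I \<times> I"]
    by (simp add: sum.cartesian_product case_prod_unfold)
  then have "(?S (\<lambda>i j. h i j * w i * w j) - t / N)\<^sup>2
      \<le> (1 - 1 / N) * (?S (\<lambda>i j. (h i j)\<^sup>2) - t\<^sup>2 / N)"
    unfolding prod hsq wsq by (simp add: mult.commute)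
  then have "?S (\<lambda>i j. h i j * w i * w j) - t / N
      \<le> sqrt ((1 - 1 / N) * (?S (\<lambda>i j. (h i j)\<^sup>2) - t\<^sup>2 / N))"
    by (rule real_le_rsqrt)
  then show ?thesis by (simp add: t_def N_def)
qed

lemma eigenvalue_real_matE:
  assumes "eigenvalue (real_mat n a) \<mu>"
  obtains x where "\<And>i. i < n \<Longrightarrow> (\<Sum>j<n. complex_of_real (a i j) * x j) = \<mu> * x i"
    and "\<exists>i<n. x i \<noteq> 0"
proof -
  obtain v where v: "v \<in> carrier_vec n" "v \<noteq> 0\<^sub>v n" "real_mat n a *\<^sub>v v = \<mu> \<cdot>\<^sub>v v"
    using assms by (auto simp: eigenvalue_def eigenvector_def real_mat_def)
  show ?thesis
  proof
    fix i assume i: "i < n"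
    have "(real_mat n a *\<^sub>v v) $ i = (\<mu> \<cdot>\<^sub>v v) $ i" by (simp add: v(3))
    then show "(\<Sum>j<n. complex_of_real (a i j) * v $ j) = \<mu> * v $ i"
      using i v(1) by (simp add: real_mat_def scalar_prod_def lessThan_atLeast0)
  next
    show "\<exists>i<n. v $ i \<noteq> 0"
      using v(1,2) by (metis carrier_vecD eq_vecI index_zero_vec)
  qed
qed

text \<open>For \<open>n > 0\<close> the spectrum is nonempty and the maximal modulus is attained,
  so there is an eigenvector to work with.\<close>

lemma spectral_radius_real_matE:
  assumes "n > 0"
  obtains \<mu> x where "norm \<mu> = spectral_radius (real_mat n a)"
    and "\<And>i. i < n \<Longrightarrow> (\<Sum>j<n. complex_of_real (a i j) * x j) = \<mu> * x i" and "\<exists>i<n. x i \<noteq> 0"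
proof -
  obtain \<mu> where \<mu>: "eigenvalue (real_mat n a) \<mu>" "norm \<mu> = spectral_radius (real_mat n a)"
    using spectral_radius_mem_max(1)[OF real_mat_carrier assms, of a]
    by (auto simp: spectrum_def)
  from \<mu>(1) show ?thesis
    by (rule eigenvalue_real_matE) (rule that[OF \<mu>(2)])
qed

lemma norm_le_spectral_radius_real_mat:
  fixes x :: "nat \<Rightarrow> complex"
  assumes "\<And>i. i < n \<Longrightarrow> (\<Sum>j<n. complex_of_real (a i j) * x j) = \<mu> * x i"
    and "\<exists>i<n. x i \<noteq> 0"
  shows "norm \<mu> \<le> spectral_radius (real_mat n a)"
proof -
  have n: "n > 0" using assms(2) by auto
  have "eigenvector (real_mat n a) (vec n x) \<mu>"
    unfolding eigenvector_def
  proof (intro conjI)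
    show "vec n x \<noteq> 0\<^sub>v (dim_row (real_mat n a))"
      using assms(2) by (auto simp: real_mat_def vec_eq_iff)
    show "real_mat n a *\<^sub>v vec n x = \<mu> \<cdot>\<^sub>v vec n x"
      using assms(1)
      by (intro eq_vecI) (auto simp: real_mat_def scalar_prod_def lessThan_atLeast0)
  qed (simp add: real_mat_def)
  then have "norm \<mu> \<in> norm ` spectrum (real_mat n a)"
    unfolding spectrum_def eigenvalue_def by blast
  then show ?thesis by (rule spectral_radius_mem_max(2)[OF real_mat_carrier n])
qed

lemma spectral_radius_real_mat_le:
  assumes n: "n > 0" and nonneg: "\<And>i j. a i j \<ge> 0"
  shows "spectral_radius (real_mat n a) \<le> (\<Sum>i<n. a i i) / n + sqrt ((1 - 1 / n) *
    ((\<Sum>i<n. \<Sum>j<n. ((a i j + a j i) / 2)\<^sup>2) - (\<Sum>i<n. a i i)\<^sup>2 / n))"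
proof -
  obtain \<mu> x where \<mu>: "norm \<mu> = spectral_radius (real_mat n a)"
    and ev: "\<And>i. i < n \<Longrightarrow> (\<Sum>j<n. complex_of_real (a i j) * x j) = \<mu> * x i" and nz: "\<exists>i<n. x i \<noteq> 0"
    by (rule spectral_radius_real_matE[OF n, of a]) blast
  define N where "N = (\<Sum>i<n. (norm (x i))\<^sup>2)"
  define w where "w i = norm (x i) / sqrt N" for i
  define h where "h i j = (a i j + a j i) / 2" for i j
  obtain k where k: "k < n" "x k \<noteq> 0" using nz by blast
  have N: "N > 0"
    unfolding N_def by (rule sum_pos2[of _ k]) (use k in auto)
  have unit: "(\<Sum>i<n. (w i)\<^sup>2) = 1"
    using N by (simp add: w_def power_divide sum_divide_distrib[symmetric] N_def[symmetric])
  \<comment> \<open>The triangle inequality and the nonnegative entries make \<open>w\<close> a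
    subinvariant vector; this replaces the exact Perron eigenvector.\<close>
  have row: "norm \<mu> * w i \<le> (\<Sum>j<n. a i j * w j)" if "i < n" for i
  proof -
    have "norm \<mu> * norm (x i) = norm (\<Sum>j<n. complex_of_real (a i j) * x j)"
      using ev[OF that] by (simp add: norm_mult)
    also have "\<dots> \<le> (\<Sum>j<n. norm (complex_of_real (a i j) * x j))" by (rule norm_sum)
    also have "\<dots> = (\<Sum>j<n. a i j * norm (x j))" by (simp add: norm_mult nonneg)
    finally show ?thesis
      using N by (simp add: w_def sum_divide_distrib[symmetric] divide_right_mono)
  qed
  have "norm \<mu> = (\<Sum>i<n. w i * (norm \<mu> * w i))"
    using unit by (simp add: power2_eq_square mult.left_commute sum_distrib_left[symmetric])
  also have "\<dots> \<le> (\<Sum>i<n. w i * (\<Sum>j<n. a i j * w j))"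
    using row N by (intro sum_mono mult_left_mono) (auto simp: w_def)
  also have "\<dots> = (\<Sum>i<n. \<Sum>j<n. a i j * w i * w j)"
    by (simp add: sum_distrib_left mult_ac)
  \<comment> \<open>Interchanging the summation indices shows that the quadratic form only sees the
    symmetric part \<open>h\<close>, which has a smaller norm than \<open>a\<close> in
    general.\<close>
  also have "\<dots> = (\<Sum>i<n. \<Sum>j<n. h i j * w i * w j)"
  proof -
    have "(\<Sum>i<n. \<Sum>j<n. a j i * w i * w j) = (\<Sum>i<n. \<Sum>j<n. a i j * w i * w j)"
      by (subst sum.swap) (simp add: mult_ac)
    moreover have "(\<Sum>i<n. \<Sum>j<n. h i j * w i * w j) =
        ((\<Sum>i<n. \<Sum>j<n. a i j * w i * w j) + (\<Sum>i<n. \<Sum>j<n. a j i * w i * w j)) / 2"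
      unfolding h_def sum.distrib[symmetric] sum_divide_distrib
      by (intro sum.cong refl) (simp add: algebra_simps)
    ultimately show ?thesis by simp
  qed
  also have "\<dots> \<le> (\<Sum>i<n. h i i) / n + sqrt ((1 - 1 / n) *
    ((\<Sum>i<n. \<Sum>j<n. (h i j)\<^sup>2) - (\<Sum>i<n. h i i)\<^sup>2 / n))"
    using quadratic_form_le[OF finite_lessThan _ unit, of h] n by auto
  finally show ?thesis by (simp add: \<mu> h_def)
qed

section \<open>Lower bound through growth of powers\<close>

lemma real_mat_pow_mult_vec:
  "real_mat n a ^\<^sub>m k *\<^sub>v vec n (\<lambda>i. of_real (f i)) =
    vec n (\<lambda>i. of_real ((mat_action n a ^^ k) f i))"
proof (induction k arbitrary: f)
  case 0
  show ?case by (simp add: real_mat_def)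
next
  case (Suc k)
  have step: "real_mat n a *\<^sub>v vec n (\<lambda>i. of_real (f i)) = vec n (\<lambda>i. of_real (mat_action n a f i))"
    by (rule eq_vecI) (auto simp: real_mat_def scalar_prod_def mat_action_def lessThan_atLeast0)
  have "real_mat n a ^\<^sub>m Suc k *\<^sub>v vec n (\<lambda>i. of_real (f i))
      = real_mat n a ^\<^sub>m k *\<^sub>v (real_mat n a *\<^sub>v vec n (\<lambda>i. of_real (f i)))"
    by (simp add: assoc_mult_mat_vec[of _ n n _ n])
  also have "\<dots> = vec n (\<lambda>i. of_real ((mat_action n a ^^ k) (mat_action n a f) i))"
    unfolding step by (rule Suc.IH)
  finally show ?case by (simp add: funpow_swap1)
qed

text \<open>Nonnegativity is carried through the same induction because multiplying the two
  inequalities in each product requires it.\<close>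

lemma mat_action_pow_mono:
  assumes "\<And>i j. 0 \<le> b i j" "\<And>i j. b i j \<le> a i j"
  shows "0 \<le> (mat_action n b ^^ k) (\<lambda>_. 1) i \<and>
    (mat_action n b ^^ k) (\<lambda>_. 1) i \<le> (mat_action n a ^^ k) (\<lambda>_. 1) i"
proof (induction k arbitrary: i)
  case (Suc k)
  have "0 \<le> a i j" for i j using assms by (meson order_trans)
  then show ?case using Suc assms
    by (auto simp: mat_action_def intro!: sum_nonneg sum_mono mult_mono)
qed simp

text \<open>Moves \<open>k\<close> factors across the inner product; this turns the squared norm of
  the \<open>k\<close>-th iterate of the all-ones function into the entry sum of the
  \<open>2 * k\<close>-th power.\<close>

lemma mat_action_pow_self_adjoint:
  assumes sym: "\<And>i j. b i j = b j i"
  shows "(\<Sum>i<n. f i * (mat_action n b ^^ k) g i) = (\<Sum>i<n. (mat_action n b ^^ k) f i * g i)"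
proof (induction k arbitrary: f)
  case (Suc k)
  have "(\<Sum>i<n. f i * mat_action n b g i) = (\<Sum>i<n. mat_action n b f i * g i)" for f g
  proof -
    have "(\<Sum>i<n. f i * mat_action n b g i) = (\<Sum>i<n. \<Sum>j<n. b j i * f i * g j)"
      by (simp add: mat_action_def sum_distrib_left mult_ac sym)
    also have "\<dots> = (\<Sum>i<n. mat_action n b f i * g i)"
      by (subst sum.swap) (simp add: mat_action_def sum_distrib_right)
    finally show ?thesis .
  qed
  then have "(\<Sum>i<n. f i * (mat_action n b ^^ Suc k) g i)
      = (\<Sum>i<n. mat_action n b f i * (mat_action n b ^^ k) g i)" by simp
  also have "\<dots> = (\<Sum>i<n. (mat_action n b ^^ k) (mat_action n b f) i * g i)"
    by (rule Suc.IH)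
  finally show ?case by (simp add: funpow_swap1)
qed simp

text \<open>The case to which the general bound is scaled: powers of \<open>a\<close> stay bounded
  here, whereas a mean row sum of \<open>b\<close> above 1 would make the entry sums of powers of
  \<open>b\<close>, and hence of \<open>a\<close>, unbounded.\<close>

lemma sum_entries_le_if_spectral_radius_less_1:
  assumes n: "n > 0" and sr: "spectral_radius (real_mat n a) < 1"
    and nonneg: "\<And>i j. 0 \<le> b i j" and le: "\<And>i j. b i j \<le> a i j"
    and sym: "\<And>i j. b i j = b j i"
  shows "(\<Sum>i<n. \<Sum>j<n. b i j) \<le> n"
proof (rule ccontr)
  assume gt: "\<not> ?thesis"
  define q where "q k = (\<Sum>i<n. (mat_action n b ^^ k) (\<lambda>_. 1) i)" for k
  define t where "t = q 1 / n"
  have q1: "q 1 = (\<Sum>i<n. \<Sum>j<n. b i j)" by (simp add: q_def mat_action_def)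
  have t: "t > 1" unfolding t_def q1 using gt n by simp
  \<comment> \<open>Cauchy-Schwarz against the all-ones function, followed by
    self-adjointness.\<close>
  have double: "(q k)\<^sup>2 \<le> n * q (2 * k)" for k
  proof -
    have "(q k)\<^sup>2 \<le> n * (\<Sum>i<n. ((mat_action n b ^^ k) (\<lambda>_. 1) i)\<^sup>2)"
      using sum_mult_square_le[of "\<lambda>_. 1" "(mat_action n b ^^ k) (\<lambda>_. 1)" "{..<n}"]
      by (simp add: q_def)
    also have "(\<Sum>i<n. ((mat_action n b ^^ k) (\<lambda>_. 1) i)\<^sup>2) = q (2 * k)"
      using mat_action_pow_self_adjoint[where b = b and n = n and k = k and f = "\<lambda>_. 1"
          and g = "(mat_action n b ^^ k) (\<lambda>_. 1)", OF sym]
      by (simp add: q_def power2_eq_square mult_2 funpow_add)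
    finally show ?thesis .
  qed
  \<comment> \<open>Squaring the induction hypothesis and cancelling one factor \<open>n\<close>
    doubles the exponent, so only powers of two are reached.\<close>
  have growth: "n * t ^ 2 ^ m \<le> q (2 ^ m)" for m
  proof (induction m)
    case 0
    show ?case using n by (simp add: t_def)
  next
    case (Suc m)
    have "(n * t ^ 2 ^ m)\<^sup>2 \<le> (q (2 ^ m))\<^sup>2"
      using Suc t by (intro power_mono) auto
    also have "\<dots> \<le> n * q (2 ^ Suc m)" using double[of "2 ^ m"] by simp
    finally have "n * (n * t ^ 2 ^ Suc m) \<le> n * q (2 ^ Suc m)"
      by (simp add: power2_eq_square power_mult mult_ac power_add[symmetric] mult_2)
    then show ?case using n by simp
  qed
  \<comment> \<open>\<open>C\<close> bounds all entries of all powers, uniformly in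
    \<open>k\<close>.\<close>
  obtain C where C: "\<And>k. norm_bound (real_mat n a ^\<^sub>m k) C"
    using spectral_radius_jnf_norm_bound_less_1_upper_triangular[OF real_mat_carrier sr] by blast
  have bounded: "q k \<le> n * (n * C)" for k
  proof -
    have "q k \<le> (\<Sum>i<n. n * C)"
      unfolding q_def
    proof (rule sum_mono)
      fix i assume "i \<in> {..<n}"
      then have i: "i < n" by simp
      let ?P = "real_mat n a ^\<^sub>m k"
      have P: "?P \<in> carrier_mat n n" by simp
      have "complex_of_real ((mat_action n a ^^ k) (\<lambda>_. 1) i) = (?P *\<^sub>v vec n (\<lambda>_. 1)) $ i"
        using real_mat_pow_mult_vec[of n a k "\<lambda>_. 1"] i by simp
      also have "\<dots> = (\<Sum>j<n. ?P $$ (i, j))"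
        using i P by (simp add: scalar_prod_def lessThan_atLeast0 carrier_matD[OF P])
      finally have "norm (complex_of_real ((mat_action n a ^^ k) (\<lambda>_. 1) i))
          \<le> (\<Sum>j<n. norm (?P $$ (i, j)))"
        using norm_sum by metis
      also have "\<dots> \<le> (\<Sum>j<n. C)"
        using C[of k] i P by (intro sum_mono) (auto simp: norm_bound_def)
      finally show "(mat_action n b ^^ k) (\<lambda>_. 1) i \<le> n * C"
        using mat_action_pow_mono[where b = b and a = a and n = n and k = k and i = i, OF nonneg le] by simp
    qed
    then show ?thesis by simp
  qed
  \<comment> \<open>An arbitrary large exponent \<open>m\<close> is raised to the available exponent
    \<open>2 ^ m\<close>, using \<open>m < 2 ^ m\<close>.\<close>
  obtain m where m: "n * C < t ^ m" using real_arch_pow[OF t] by blast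
  also have "t ^ m \<le> t ^ 2 ^ m"
    using t less_exp[of m] by (intro power_increasing) auto
  finally have "n * (n * C) < n * t ^ 2 ^ m" using n by simp
  with growth[of m] bounded[of "2 ^ m"] show False by linarith
qed

text \<open>Dividing by any \<open>r\<close> above the spectral radius reduces to the case of radius
  below 1; the claim follows as \<open>r\<close> decreases to the radius.\<close>

lemma sum_entries_le_spectral_radius:
  assumes n: "n > 0" and nonneg: "\<And>i j. 0 \<le> b i j" and le: "\<And>i j. b i j \<le> a i j"
    and sym: "\<And>i j. b i j = b j i"
  shows "(\<Sum>i<n. \<Sum>j<n. b i j) / n \<le> spectral_radius (real_mat n a)"
proof (rule dense_ge)
  fix r assume r: "spectral_radius (real_mat n a) < r"
  \<comment> \<open>This makes every such \<open>r\<close> positive, also when the radius is 0 and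
    could not itself serve as divisor.\<close>
  have "0 \<le> spectral_radius (real_mat n a)"
    using spectral_radius_mem_max(1)[OF real_mat_carrier n] by (metis imageE norm_ge_zero)
  with r have r0: "r > 0" by simp
  obtain \<mu> x where \<mu>: "norm \<mu> = spectral_radius (real_mat n (\<lambda>i j. a i j / r))"
    and ev: "\<And>i. i < n \<Longrightarrow> (\<Sum>j<n. complex_of_real (a i j / r) * x j) = \<mu> * x i"
    and nz: "\<exists>i<n. x i \<noteq> 0"
    by (rule spectral_radius_real_matE[OF n, of "\<lambda>i j. a i j / r"]) blast
  \<comment> \<open>An eigenvector of the scaled matrix for \<open>\<mu>\<close> is one of
    \<open>a\<close> for \<open>r * \<mu>\<close>, so the radius scales as expected.\<close>
  have "norm (of_real r * \<mu>) \<le> spectral_radius (real_mat n a)"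
  proof (rule norm_le_spectral_radius_real_mat[OF _ nz])
    fix i assume "i < n"
    then show "(\<Sum>j<n. complex_of_real (a i j) * x j) = of_real r * \<mu> * x i"
      using ev[of i] r0 by (simp add: sum_divide_distrib[symmetric] field_simps)
  qed
  then have "r * norm \<mu> \<le> spectral_radius (real_mat n a)" using r0 by (simp add: norm_mult)
  with r have "r * norm \<mu> < r * 1" by linarith
  then have "norm \<mu> < 1" using r0 by (simp only: mult_less_cancel_left_pos)
  then have "(\<Sum>i<n. \<Sum>j<n. b i j / r) \<le> n"
    using nonneg le r0
    by (intro sum_entries_le_if_spectral_radius_less_1[OF n, of "\<lambda>i j. a i j / r"])
      (auto simp: \<mu> divide_right_mono sym)
  then show "(\<Sum>i<n. \<Sum>j<n. b i j) / n \<le> r"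
    using r0 n by (simp add: sum_divide_distrib[symmetric] field_simps)
qed

section \<open>Bounds for a single digraph\<close>

lemma parcs_subset:
  assumes "pair_fin_digraph D"
  shows "parcs D \<subseteq> pverts D \<times> pverts D"
  using pair_fin_digraph.axioms(1)[OF assms]
  by (auto dest: pair_wf_digraph.in_arcsD1 pair_wf_digraph.in_arcsD2)

lemma spectral_radius_adjacency_mat_bounds:
  fixes D :: "'a pair_pre_digraph" and n \<sigma> :: real
  assumes fin: "pair_fin_digraph D" and ne: "pverts D \<noteq> {}"
    and vs: "distinct vs" "set vs = pverts D"
  defines "n \<equiv> real (card (pverts D))" and "\<sigma> \<equiv> real (card (loop_set D))"
  shows "(c2 D + \<sigma>) / n \<le> spectral_radius (adjacency_mat vs D) \<and>
    spectral_radius (adjacency_mat vs D) \<le> \<sigma> / n +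
      sqrt ((1 - 1 / n) * ((card (parcs D) + c2 D + \<sigma>) / 2 - \<sigma>\<^sup>2 / n))"
proof -
  note D = pair_fin_digraph.pair_finite_verts[OF fin] pair_fin_digraph.pair_finite_arcs[OF fin]
    parcs_subset[OF fin]
  note [simp] = D(1,2)
  define l where "l = length vs"
  define g where "g u v = (of_bool ((u, v) \<in> parcs D) :: real)" for u v
  define a where "a i j = g (vs ! i) (vs ! j)" for i j
  have l: "l = card (pverts D)" using vs by (metis distinct_card l_def)
  have l0: "l > 0" using ne D(1) by (simp add: l card_gt_0_iff)
  have ln: "real l = n" by (simp add: l n_def)
  have A: "adjacency_mat vs D = real_mat l a"
    by (auto simp: adjacency_mat_def real_mat_def l_def a_def g_def)
  \<comment> \<open>The enumeration turns sums over indices into sums over vertices, which then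
    become cardinalities.\<close>
  have bij: "bij_betw ((!) vs) {..<l} (pverts D)"
    using vs by (simp add: l_def bij_betw_nth)
  have reindex: "(\<Sum>i<l. f (vs ! i)) = (\<Sum>v\<in>pverts D. f v)" for f :: "'a \<Rightarrow> real"
    by (rule sum.reindex_bij_betw[OF bij])
  have reindex2: "(\<Sum>i<l. \<Sum>j<l. f (vs ! i) (vs ! j)) = (\<Sum>(u, v)\<in>pverts D \<times> pverts D. f u v)"
    for f :: "'a \<Rightarrow> 'a \<Rightarrow> real"
  proof -
    have "(\<Sum>i<l. \<Sum>j<l. f (vs ! i) (vs ! j)) = (\<Sum>i<l. \<Sum>v\<in>pverts D. f (vs ! i) v)"
      by (simp add: reindex)
    also have "\<dots> = (\<Sum>u\<in>pverts D. \<Sum>v\<in>pverts D. f u v)" by (rule reindex)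
    finally show ?thesis by (simp add: sum.cartesian_product)
  qed
  have arc: "u \<in> pverts D \<and> v \<in> pverts D" if "(u, v) \<in> parcs D" for u v
    using that D(3) by blast
  have trace: "(\<Sum>i<l. a i i) = \<sigma>"
    unfolding a_def reindex[of "\<lambda>v. g v v"] unfolding g_def \<sigma>_def loop_set_def
    by (simp add: Int_def)
  have arcs: "(\<Sum>i<l. \<Sum>j<l. a i j) = card (parcs D)"
  proof -
    have "(\<Sum>i<l. \<Sum>j<l. a i j) = (\<Sum>p\<in>pverts D \<times> pverts D. of_bool (p \<in> parcs D))"
      unfolding a_def reindex2[of g] by (simp add: g_def case_prod_unfold)
    also have "\<dots> = card ((pverts D \<times> pverts D) \<inter> parcs D)"
      by simp
    also have "(pverts D \<times> pverts D) \<inter> parcs D = parcs D" using arc by auto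
    finally show ?thesis by simp
  qed
  \<comment> \<open>The trace of the squared adjacency matrix counts closed walks of length two: the
    pairs of distinct vertices in \<open>W\<close>, and one walk for each loop.\<close>
  have walks: "(\<Sum>i<l. \<Sum>j<l. a i j * a j i) = c2 D + \<sigma>"
  proof -
    define W where "W = {(v, w). v \<noteq> w \<and> (v, w) \<in> parcs D \<and> (w, v) \<in> parcs D}"
    have W: "W \<subseteq> pverts D \<times> pverts D" using arc by (auto simp: W_def)
    then have finW: "finite W" by (rule finite_subset) simp
    have "(\<Sum>i<l. \<Sum>j<l. a i j * a j i) =
        (\<Sum>p\<in>pverts D \<times> pverts D. of_bool (p \<in> {(v, w). (v, w) \<in> parcs D \<and> (w, v) \<in> parcs D}))"
      unfolding a_def reindex2[of "\<lambda>u v. g u v * g v u"]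
      by (intro sum.cong) (auto simp: g_def)
    also have "\<dots> = card ((pverts D \<times> pverts D) \<inter> {(v, w). (v, w) \<in> parcs D \<and> (w, v) \<in> parcs D})"
      by simp
    also have "(pverts D \<times> pverts D) \<inter> {(v, w). (v, w) \<in> parcs D \<and> (w, v) \<in> parcs D}
        = W \<union> (\<lambda>v. (v, v)) ` loop_set D"
      using arc by (auto simp: W_def loop_set_def)
    also have "card \<dots> = card W + card ((\<lambda>v. (v, v)) ` loop_set D)"
      by (rule card_Un_disjoint) (auto simp: finW, auto simp: W_def loop_set_def)
    also have "card ((\<lambda>v. (v, v)) ` loop_set D) = card (loop_set D)"
      by (rule card_image) (simp add: inj_on_def)
    finally show ?thesis by (simp add: c2_def W_def \<sigma>_def)
  qed
  have a01: "0 \<le> a i j" "a i j \<le> 1" "(a i j)\<^sup>2 = a i j" for i j by (simp_all add: a_def g_def)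
  \<comment> \<open>The comparison matrix \<open>a i j * a j i\<close> is symmetric and lies below
    \<open>a\<close> because all entries are at most 1.\<close>
  have lower: "(c2 D + \<sigma>) / n \<le> spectral_radius (adjacency_mat vs D)"
    using sum_entries_le_spectral_radius[of l "\<lambda>i j. a i j * a j i" a] l0 a01
    by (simp add: A walks ln mult_left_le mult.commute)
  have "(\<Sum>i<l. \<Sum>j<l. ((a i j + a j i) / 2)\<^sup>2)
      = (\<Sum>i<l. \<Sum>j<l. (1/4) * a i j + (1/4) * a j i + (1/2) * (a i j * a j i))"
  proof (intro sum.cong refl)
    fix i j
    have "((a i j + a j i) / 2)\<^sup>2 = (1/4) * (a i j)\<^sup>2 + (1/4) * (a j i)\<^sup>2 + (1/2) * (a i j * a j i)"
      by (simp add: power2_eq_square algebra_simps)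
    then show "((a i j + a j i) / 2)\<^sup>2 = (1/4) * a i j + (1/4) * a j i + (1/2) * (a i j * a j i)"
      by (simp only: a01(3))
  qed
  also have "\<dots> = (1/4) * (\<Sum>i<l. \<Sum>j<l. a i j) + (1/4) * (\<Sum>i<l. \<Sum>j<l. a j i)
      + (1/2) * (\<Sum>i<l. \<Sum>j<l. a i j * a j i)"
    by (simp only: sum.distrib sum_distrib_left)
  also have "(\<Sum>i<l. \<Sum>j<l. a j i) = (\<Sum>i<l. \<Sum>j<l. a i j)" by (rule sum.swap)
  finally have "(\<Sum>i<l. \<Sum>j<l. ((a i j + a j i) / 2)\<^sup>2) = (card (parcs D) + c2 D + \<sigma>) / 2"
    by (simp add: arcs walks)
  then have "spectral_radius (adjacency_mat vs D) \<le> \<sigma> / n +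
      sqrt ((1 - 1 / n) * ((card (parcs D) + c2 D + \<sigma>) / 2 - \<sigma>\<^sup>2 / n))"
    using spectral_radius_real_mat_le[OF l0, of a, OF a01(1)] by (simp only: A trace ln)
  with lower show ?thesis by simp
qed

section \<open>Loops and arcs of the complement\<close>

lemma card_loop_set_complement:
  assumes "pair_fin_digraph D"
  shows "real (card (loop_set (digraph_complement D))) =
    (1 - loop_delta D) * real (card (pverts D)) - real (card (loop_set D))"
proof -
  note [simp] = pair_fin_digraph.pair_finite_verts[OF assms(1)] pair_fin_digraph.pair_finite_arcs[OF assms(1)]
  have fin: "finite (loop_set D)" by (simp add: loop_set_def)
  show ?thesis
  proof (cases "card (loop_set D) = 0")
    case True
    then have "loop_set (digraph_complement D) = {}"
      by (auto simp: loop_set_def digraph_complement_def)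
    then show ?thesis using True by (simp add: loop_delta_def)
  next
    case False
    then have "loop_set (digraph_complement D) = pverts D - loop_set D"
      by (auto simp: loop_set_def digraph_complement_def)
    moreover have sub: "loop_set D \<subseteq> pverts D" by (auto simp: loop_set_def)
    ultimately show ?thesis
      using False fin card_mono[OF _ sub]
      by (simp add: card_Diff_subset of_nat_diff loop_delta_def)
  qed
qed

lemma card_parcs_complement:
  assumes "pair_fin_digraph D"
  shows "real (card (parcs (digraph_complement D))) = (real (card (pverts D)))\<^sup>2
    - loop_delta D * real (card (pverts D)) - real (card (parcs D))"
proof -
  note [simp] = pair_fin_digraph.pair_finite_verts[OF assms(1)] pair_fin_digraph.pair_finite_arcs[OF assms(1)]
  let ?V = "pverts D"
  \<comment> \<open>\<open>L\<close> is the diagonal that the complement leaves out when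
    \<open>D\<close> is loopless; in that case it is disjoint from the arcs of
    \<open>D\<close>.\<close>
  define L where "L = (if card (loop_set D) = 0 then (\<lambda>v. (v, v)) ` ?V else {})"
  have fin: "finite (loop_set D)" by (simp add: loop_set_def)
  have finL: "finite L" by (simp add: L_def)
  have arcs: "parcs D \<subseteq> ?V \<times> ?V" by (rule parcs_subset[OF assms(1)])
  have disj: "parcs D \<inter> L = {}"
    using fin by (auto simp: L_def loop_set_def)
  have sub: "parcs D \<union> L \<subseteq> ?V \<times> ?V" using arcs by (auto simp: L_def)
  have "parcs (digraph_complement D) = ?V \<times> ?V - (parcs D \<union> L)"
    by (auto simp: digraph_complement_def L_def)
  moreover have "card (parcs D \<union> L) = card (parcs D) + card L"
    using disj finL by (intro card_Un_disjoint) auto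
  moreover have "real (card L) = loop_delta D * real (card ?V)"
    by (simp add: L_def loop_delta_def card_image inj_on_def)
  ultimately show ?thesis
    using sub finL card_mono[OF _ sub]
    by (simp add: card_Diff_subset of_nat_diff card_cartesian_product power2_eq_square)
qed

section \<open>Combining the bounds for both digraphs\<close>

lemma sqrt_add_sqrt_le:
  fixes x y :: real
  assumes "0 \<le> x" "0 \<le> y"
  shows "sqrt x + sqrt y \<le> sqrt (2 * (x + y))"
proof (rule real_le_rsqrt)
  have "0 \<le> (sqrt x - sqrt y)\<^sup>2" by simp
  then show "(sqrt x + sqrt y)\<^sup>2 \<le> 2 * (x + y)"
    using assms by (simp add: power2_sum power2_diff)
qed

text \<open>Ensures nonnegative radicands when the square roots are added. With \<sigma> loops, n
  vertices and m arcs, \<sigma> \<le> n gives \<sigma>^2 / n \<le> \<sigma>, and \<sigma> \<le> m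
  bounds \<sigma> by (m + \<sigma>) / 2.\<close>

lemma loop_set_square_le:
  assumes "pair_fin_digraph D" and "pverts D \<noteq> {}"
  shows "(real (card (loop_set D)))\<^sup>2 / card (pverts D)
    \<le> (card (parcs D) + c2 D + real (card (loop_set D))) / 2"
proof -
  note [simp] = pair_fin_digraph.pair_finite_verts[OF assms(1)] pair_fin_digraph.pair_finite_arcs[OF assms(1)]
  have "card (loop_set D) \<le> card (pverts D)"
    by (rule card_mono) (auto simp: loop_set_def)
  moreover have "card (loop_set D) \<le> card (parcs D)"
    by (rule card_inj_on_le[of "\<lambda>v. (v, v)"]) (auto simp: loop_set_def inj_on_def)
  moreover have "0 < card (pverts D)" using assms(2) by (simp add: card_gt_0_iff)
  ultimately have "(real (card (loop_set D)))\<^sup>2 / card (pverts D) \<le> card (loop_set D)"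
    by (simp add: power2_eq_square pos_divide_le_eq mult_left_mono)
  moreover have "real (card (loop_set D)) \<le> card (parcs D)"
    using \<open>card (loop_set D) \<le> card (parcs D)\<close> by simp
  moreover have "0 \<le> real (c2 D)" by simp
  ultimately show ?thesis unfolding of_nat_add by argo
qed

text \<open>The arc numbers cancel because \<open>m + m'\<close> depends only on \<open>n\<close>
  and \<open>\<delta>\<close>. The left side becomes (1 - 1/n) (n^2 - n + 4 \<sigma> (n - \<sigma>)
  / n + k + k') in both cases: for \<open>\<delta> = 0\<close> by \<sigma>^2 + (n - \<sigma>)^2 =
  n^2 - 2 \<sigma> (n - \<sigma>), for \<open>\<delta> = 1\<close> because both loop numbers
  vanish.\<close>

lemma complement_radicand:
  fixes n \<sigma> m k \<delta> :: real
  assumes "n > 0" and "\<delta> = 0 \<or> \<delta> = 1 \<and> \<sigma> = 0"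
    and "\<sigma>' = (1 - \<delta>) * n - \<sigma>" and "m' = n\<^sup>2 - \<delta> * n - m"
  shows "2 * ((1 - 1 / n) * ((m + k + \<sigma>) / 2 - \<sigma>\<^sup>2 / n) + (1 - 1 / n) * ((m' + k' + \<sigma>') / 2 - \<sigma>'\<^sup>2 / n)) =
    (n - 1)\<^sup>2 - 4 * \<sigma> * (n - \<sigma>) / n\<^sup>2 + 4 * \<sigma> * (n - \<sigma>) / n + (n - 1) * (k + k') / n"
  using assms(2)
proof
  assume "\<delta> = 0"
  then show ?thesis
    using assms(1) by (simp add: assms(3,4) field_simps power2_eq_square)
next
  assume "\<delta> = 1 \<and> \<sigma> = 0"
  then show ?thesis
    using assms(1) by (simp add: assms(3,4) field_simps power2_eq_square)
qed

lemma spectral_radius_add_complement_ge: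
  assumes fin: "pair_fin_digraph D" and ne: "pverts D \<noteq> {}"
    and vs: "distinct vs" "set vs = pverts D"
  shows "1 - loop_delta D + (real (c2 D) + real (c2 (digraph_complement D))) / real (card (pverts D))
    \<le> spectral_radius (adjacency_mat vs D) + spectral_radius (adjacency_mat vs (digraph_complement D))"
proof -
  let ?D' = "digraph_complement D"
  define n where "n = real (card (pverts D))"
  define \<sigma> where "\<sigma> = real (card (loop_set D))"
  define \<sigma>' where "\<sigma>' = real (card (loop_set ?D'))"
  have fin': "pair_fin_digraph ?D'" by (rule pair_fin_digraph_complement[OF fin])
  have verts': "pverts ?D' = pverts D" by (simp add: digraph_complement_def)
  have n: "n > 0"
    using ne pair_fin_digraph.pair_finite_verts[OF fin] by (simp add: n_def card_gt_0_iff)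
  have "\<sigma> + \<sigma>' = (1 - loop_delta D) * n"
    by (simp add: n_def \<sigma>_def \<sigma>'_def card_loop_set_complement[OF fin])
  \<comment> \<open>The loop terms of the two separate bounds add up to exactly the summand outside
    the fraction.\<close>
  then have loops: "\<sigma> / n + \<sigma>' / n = 1 - loop_delta D"
    using n by (simp add: add_divide_distrib[symmetric])
  have "(c2 D + \<sigma>) / n \<le> spectral_radius (adjacency_mat vs D)"
    using spectral_radius_adjacency_mat_bounds[OF fin ne vs] by (simp add: n_def \<sigma>_def)
  moreover have "(c2 ?D' + \<sigma>') / n \<le> spectral_radius (adjacency_mat vs ?D')"
    using spectral_radius_adjacency_mat_bounds[OF fin' _ vs(1), unfolded verts', OF ne vs(2)]
    by (simp add: n_def \<sigma>'_def)
  ultimately show ?thesis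
    unfolding n_def[symmetric] loops[symmetric] by (simp add: add_divide_distrib)
qed

lemma spectral_radius_add_complement_le:
  fixes n \<sigma> :: real
  assumes fin: "pair_fin_digraph D" and ne: "pverts D \<noteq> {}"
    and vs: "distinct vs" "set vs = pverts D"
  defines "n \<equiv> real (card (pverts D))" and "\<sigma> \<equiv> real (card (loop_set D))"
  shows "spectral_radius (adjacency_mat vs D) + spectral_radius (adjacency_mat vs (digraph_complement D))
    \<le> 1 - loop_delta D + sqrt ((n - 1)\<^sup>2 - 4 * \<sigma> * (n - \<sigma>) / n\<^sup>2 + 4 * \<sigma> * (n - \<sigma>) / n
      + (n - 1) * (real (c2 D) + real (c2 (digraph_complement D))) / n)"
proof -
  let ?D' = "digraph_complement D"
  define m where "m = real (card (parcs D))"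
  define m' where "m' = real (card (parcs ?D'))"
  define \<sigma>' where "\<sigma>' = real (card (loop_set ?D'))"
  define x where "x = (1 - 1 / n) * ((m + c2 D + \<sigma>) / 2 - \<sigma>\<^sup>2 / n)"
  define y where "y = (1 - 1 / n) * ((m' + c2 ?D' + \<sigma>') / 2 - \<sigma>'\<^sup>2 / n)"
  have fin': "pair_fin_digraph ?D'" by (rule pair_fin_digraph_complement[OF fin])
  have verts': "pverts ?D' = pverts D" by (simp add: digraph_complement_def)
  \<comment> \<open>The bound 1, not mere positivity, makes the factor \<open>1 - 1 / n\<close> of
    both radicands nonnegative.\<close>
  have n: "n \<ge> 1"
    using ne pair_fin_digraph.pair_finite_verts[OF fin]
    by (simp add: n_def Suc_le_eq card_gt_0_iff)
  have \<sigma>': "\<sigma>' = (1 - loop_delta D) * n - \<sigma>"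
    unfolding \<sigma>'_def n_def \<sigma>_def by (rule card_loop_set_complement[OF fin])
  have m': "m' = n\<^sup>2 - loop_delta D * n - m"
    unfolding m'_def n_def m_def by (rule card_parcs_complement[OF fin])
  have \<delta>: "loop_delta D = (0::real) \<or> loop_delta D = (1::real) \<and> \<sigma> = 0"
    by (simp add: loop_delta_def \<sigma>_def)
  have loops: "\<sigma> / n + \<sigma>' / n = 1 - loop_delta D"
    using n by (simp add: \<sigma>' field_simps)
  have upper: "spectral_radius (adjacency_mat vs D) \<le> \<sigma> / n + sqrt x"
    using spectral_radius_adjacency_mat_bounds[OF fin ne vs] by (simp add: m_def x_def n_def \<sigma>_def)
  have upper': "spectral_radius (adjacency_mat vs ?D') \<le> \<sigma>' / n + sqrt y"
    using spectral_radius_adjacency_mat_bounds[OF fin' _ vs(1), unfolded verts', OF ne vs(2)]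
    by (simp add: m'_def y_def n_def \<sigma>'_def)
  have "0 \<le> x" "0 \<le> y"
    using n loop_set_square_le[OF fin ne] loop_set_square_le[OF fin', unfolded verts', OF ne]
    by (simp_all add: m_def m'_def x_def y_def n_def \<sigma>_def \<sigma>'_def)
  then have "sqrt x + sqrt y \<le> sqrt (2 * (x + y))"
    by (rule sqrt_add_sqrt_le)
  then have "spectral_radius (adjacency_mat vs D) + spectral_radius (adjacency_mat vs ?D')
      \<le> 1 - loop_delta D + sqrt (2 * (x + y))"
    using upper upper' loops by linarith
  then show ?thesis
    unfolding x_def y_def using complement_radicand[OF _ \<delta> \<sigma>' m'] n by simp
qed

theorem lemma5p11:
  fixes D :: "'a pair_pre_digraph" and vs :: "'a list" and n \<sigma> :: nat
    and \<delta> \<rho> \<rho>' c c' :: real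
  assumes "pair_fin_digraph D" and "pverts D \<noteq> {}"
    and "distinct vs" and "set vs = pverts D"
    and "n = card (pverts D)" and "\<sigma> = card (loop_set D)" and "\<delta> = loop_delta D"
    and "\<rho> = spectral_radius (adjacency_mat vs D)"
    and "\<rho>' = spectral_radius (adjacency_mat vs (digraph_complement D))"
    and "c = real (c2 D)" and "c' = real (c2 (digraph_complement D))"
  shows "1 - \<delta> + (c + c') / real n \<le> \<rho> + \<rho>' \<and>
    \<rho> + \<rho>' \<le> 1 - \<delta> + sqrt ((real n - 1)\<^sup>2
      - 4 * real \<sigma> * (real n - real \<sigma>) / (real n)\<^sup>2
      + 4 * real \<sigma> * (real n - real \<sigma>) / real n
      + (real n - 1) * (c + c') / real n)"
  unfolding assms(5-11)
  using spectral_radius_add_complement_ge[OF assms(1-4)] spectral_radius_add_complement_le[OF assms(1-4)]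
  by (rule conjI)

end
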